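(* Let $L_1,L_2\in(0,\infty]$ and $\mu_1,\mu_2\in[0,\infty)$ with $L_1>\mu_2$ and $L_2>\mu_1$, and suppose that at least one of $L_1,L_2$ is finite. Let $f_1\in\mathcal{F}_{\mu_1,L_1}(\mathbb{R}^n)$, $f_2\in\mathcal{F}_{\mu_2,L_2}(\mathbb{R}^n)$, let $f=f_1-f_2$ be lower semicontinuous and bounded below, and let $f^\star\in\mathbb{R}$ be a lower bound of $f$ on $\mathbb{R}^n$. Let $x^1\in\mathbb{R}^n$ with $f(x^1)>f^\star$, and suppose that $f$ satisfies the Polyak-Łojasiewicz inequality with constant $\eta>0$ on $X=\{x: f(x)\leq f(x^1)\}$. If $x^2$ is obtained from $x^1$ by one iteration of the DCA, then $$\frac{f(x^2)-f^\star}{f(x^1)-f^\star}\leq \frac{1-\frac{\eta}{L_1}}{1+\frac{\eta}{L_2}},$$ where $\frac{\eta}{\infty}=0$.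
   Context: $\|\cdot\|$ and $\langle\cdot,\cdot\rangle$ are the Euclidean norm and inner product on $\mathbb{R}^n$. For an extended-valued convex function $h$, $\partial h(x)=\{g: h(y)\ge h(x)+\langle g,y-x\rangle\ \forall y\in\mathbb{R}^n\}$ for $x$ with $h(x)<\infty$. For $L\in(0,\infty]$, $h$ is $L$-smooth if $\|g_1-g_2\|\le L\|x_1-x_2\|$ for all $x_1,x_2\in\mathbb{R}^n$, $g_1\in\partial h(x_1)$, $g_2\in\partial h(x_2)$ (if $L<\infty$ then $h$ is finite and differentiable on $\mathbb{R}^n$; every convex function is $\infty$-smooth). For $\mu\ge0$, $h$ is $\mu$-strongly convex if $x\mapsto h(x)-\frac{\mu}{2}\|x\|^2$ is convex. $\mathcal{F}_{\mu,L}(\mathbb{R}^n)$ is the set of closed proper convex functions $h:\mathbb{R}^n\to(-\infty,\infty]$ that are $L$-smooth and $\mu$-strongly convex. The difference $f_1-f_2$ is taken to be $+\infty$ wherever $f_1=+\infty$. General subdifferential: for $f$ lower semicontinuous and $f(\bar x)$ finite, $g$ is a regular subgradient of $f$ at $\bar x$, $g\in\hat\partial_l f(\bar x)$, if $f(x)\ge f(\bar x)+\langle g,x-\bar x\rangle+o(\|x-\bar x\|)$ for $x$ in a neighbourhood of $\bar x$; $g$ is a general subgradient, $g\in\partial_l f(\bar x)$, if there are sequences $x^i\to\bar x$ with $f(x^i)\to f(\bar x)$ and $g^i\in\hat\partial_l f(x^i)$ with $g^i\to g$. $\operatorname{co}$ denotes convex hull. Polyak-Łojasiewicz (PL) inequality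 on $X$ with constant $\eta>0$: $f(x)-f^\star\le\frac{1}{2\eta}\|\xi\|^2$ for all $x\in X$ and all $\xi\in\operatorname{co}(\partial_l f(x))$. DCA (Difference-of-Convex Algorithm), one iteration: choose $g_2^1\in\partial f_2(x^1)$ and then $x^{2}\in\operatorname{argmin}_{x\in\mathbb{R}^n}\, f_1(x)-f_2(x^1)-\langle g_2^1,x-x^1\rangle$. It is assumed that $x^2$ exists and that $\partial f_1(x^k)\neq\emptyset$ and $\partial f_2(x^k)\ne\emptyset$ for $k=1,2$. *)

theory Defs
  imports "HOL-Analysis.Analysis" "HOL-Library.Landau_Symbols"
begin

definition ext_epigraph :: "(real^'n \<Rightarrow> ereal) \<Rightarrow> ((real^'n) \<times> real) set" where
  "ext_epigraph h = {(x, t). h x \<le> ereal t}"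

definition convex_fun :: "(real^'n \<Rightarrow> ereal) \<Rightarrow> bool" where
  "convex_fun h \<longleftrightarrow> convex (ext_epigraph h)"

definition closed_fun :: "(real^'n \<Rightarrow> ereal) \<Rightarrow> bool" where
  "closed_fun h \<longleftrightarrow> closed (ext_epigraph h)"

definition proper_fun :: "(real^'n \<Rightarrow> ereal) \<Rightarrow> bool" where
  "proper_fun h \<longleftrightarrow> (\<forall>x. h x \<noteq> -\<infinity>) \<and> (\<exists>x. h x < \<infinity>)"

definition lower_semicont :: "(real^'n \<Rightarrow> ereal) \<Rightarrow> bool" where
  "lower_semicont h \<longleftrightarrow> (\<forall>x. h x \<le> Liminf (at x) h)"

text \<open>The convex subdifferential is empty outside the effective domain.\<close>

definition subdiff :: "(real^'n \<Rightarrow> ereal) \<Rightarrow> real^'n \<Rightarrow> (real^'n) set" where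
  "subdiff h x = {g. h x < \<infinity> \<and> (\<forall>y. h y \<ge> h x + ereal (g \<bullet> (y - x)))}"

text \<open>The case \<open>L = \<infinity>\<close> is separated because \<open>\<infinity> * 0 = 0\<close> in \<^typ>\<open>ereal\<close>: the bare
  inequality would force every subdifferential to have at most one element, whereas every
  convex function is to be \<open>\<infinity>\<close>-smooth. For finite \<open>L\<close> and closed proper convex \<open>h\<close>, that
  \<open>h\<close> is finite and differentiable everywhere is a consequence of the inequality.\<close>

definition smooth_fun :: "ereal \<Rightarrow> (real^'n \<Rightarrow> ereal) \<Rightarrow> bool" where
  "smooth_fun L h \<longleftrightarrow> L = \<infinity> \<or>
     (\<forall>x1 x2. \<forall>g1\<in>subdiff h x1. \<forall>g2\<in>subdiff h x2.
        ereal (norm (g1 - g2)) \<le> L * ereal (norm (x1 - x2)))"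

definition strongly_convex_fun :: "real \<Rightarrow> (real^'n \<Rightarrow> ereal) \<Rightarrow> bool" where
  "strongly_convex_fun \<mu> h \<longleftrightarrow> convex_fun (\<lambda>x. h x - ereal (\<mu> / 2 * (norm x)\<^sup>2))"

definition F_class :: "real \<Rightarrow> ereal \<Rightarrow> (real^'n \<Rightarrow> ereal) set" where
  "F_class \<mu> L = {h. closed_fun h \<and> proper_fun h \<and> convex_fun h \<and>
                     smooth_fun L h \<and> strongly_convex_fun \<mu> h}"

definition dc_diff :: "(real^'n \<Rightarrow> ereal) \<Rightarrow> (real^'n \<Rightarrow> ereal) \<Rightarrow> real^'n \<Rightarrow> ereal" where
  "dc_diff f1 f2 x = (if f1 x = \<infinity> then \<infinity> else f1 x - f2 x)"

definition regular_subdiff :: "(real^'n \<Rightarrow> ereal) \<Rightarrow> real^'n \<Rightarrow> (real^'n) set" where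
  "regular_subdiff f xb = {g. \<bar>f xb\<bar> \<noteq> \<infinity> \<and>
     (\<exists>r :: real^'n \<Rightarrow> real. r \<in> o[at xb](\<lambda>x. norm (x - xb)) \<and>
        (\<forall>\<^sub>F x in at xb. f x \<ge> f xb + ereal (g \<bullet> (x - xb) + r x)))}"

definition general_subdiff :: "(real^'n \<Rightarrow> ereal) \<Rightarrow> real^'n \<Rightarrow> (real^'n) set" where
  "general_subdiff f xb = {g. \<bar>f xb\<bar> \<noteq> \<infinity> \<and>
     (\<exists>(X :: nat \<Rightarrow> real^'n) G. X \<longlonglongrightarrow> xb \<and> (\<lambda>i. f (X i)) \<longlonglongrightarrow> f xb \<and>
        (\<forall>i. G i \<in> regular_subdiff f (X i)) \<and> G \<longlonglongrightarrow> g)}"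

definition PL_inequality ::
    "(real^'n \<Rightarrow> ereal) \<Rightarrow> real \<Rightarrow> real \<Rightarrow> (real^'n) set \<Rightarrow> bool" where
  "PL_inequality f fstar \<eta> X \<longleftrightarrow>
     (\<forall>x\<in>X. \<forall>\<xi>\<in>convex hull (general_subdiff f x).
        f x - ereal fstar \<le> ereal (1 / (2 * \<eta>) * (norm \<xi>)\<^sup>2))"

definition DCA_step ::
    "(real^'n \<Rightarrow> ereal) \<Rightarrow> (real^'n \<Rightarrow> ereal) \<Rightarrow> real^'n \<Rightarrow> real^'n \<Rightarrow> bool" where
  "DCA_step f1 f2 x1 x2 \<longleftrightarrow>
     (\<exists>g\<in>subdiff f2 x1.
        is_arg_min (\<lambda>x. f1 x - f2 x1 - ereal (g \<bullet> (x - x1))) (\<lambda>x. True) x2)"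

end

theory Submission
  imports Defs
begin

text \<open>
  Let \<open>g\<close> be the subgradient of \<open>f2\<close> at \<open>x1\<close> used by the step; optimality of \<open>x2\<close> makes it a
  subgradient of \<open>f1\<close> at \<open>x2\<close> as well. For an \<open>L\<close>-smooth convex function the subgradient
  inequality improves by \<open>1 / (2 * L)\<close> times the squared distance of the two gradients
  (\<open>convex_gradient_lower_bound\<close>). Applied to \<open>f1\<close> from \<open>x2\<close> to \<open>x1\<close> and to \<open>f2\<close> from \<open>x1\<close> to
  \<open>x2\<close>, it gives
  \<open>f x1 - f x2 \<ge> 1 / (2 * L1) * (norm (g1 - g))\<^sup>2 + 1 / (2 * L2) * (norm (g - g2))\<^sup>2\<close>
  with \<open>g1 = \<nabla>f1(x1)\<close> and \<open>g2 = \<nabla>f2(x2)\<close>; the term of an infinite \<open>L\<close> is absent, so a gradient is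
  only needed where it exists. If \<open>g1 - g\<close> and \<open>g - g2\<close> are admissible in the
  Polyak-Lojasiewicz inequality at \<open>x1\<close> and \<open>x2\<close>, the two squares are at least
  \<open>2 * \<eta> * (f x1 - fstar)\<close> and \<open>2 * \<eta> * (f x2 - fstar)\<close>, and solving for \<open>f x2 - fstar\<close> gives
  the rate.

  Admissibility is asymmetric. At \<open>x2\<close>, where \<open>f2\<close> is smooth, \<open>f1\<close> lies above an affine
  function and \<open>f2\<close> below a quadratic one, so \<open>g - g2\<close> is even a regular subgradient. At \<open>x1\<close>,
  where \<open>f1\<close> is smooth, the concave part \<open>- f2\<close> may fail to have any regular subgradient, and
  \<open>g1 - g\<close> only lies in the convex hull of limits of subgradients at nearby points. This is
  \<open>gradient_minus_subgradient_in_hull\<close>: were it outside, a hyperplane with normal \<open>d\<close> would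
  separate it from the hull, whereas following proximal subgradients near \<open>x1 + t d\<close> for
  \<open>t \<rightarrow> 0\<close> leads, by monotonicity of the subdifferential of \<open>f2\<close>, to a limit on the wrong side.

  The gradients come from the Lipschitz condition on subgradients: by
  \<open>subdiff_nonempty_if_smooth\<close>, if this condition holds with finite \<open>L\<close>, a closed proper convex
  function with a subgradient somewhere is finite and has a subgradient everywhere, and taking
  both points equal in the condition shows that this subgradient is unique.
\<close>

section \<open>Quadratic bounds for convex functions with Lipschitz gradient\<close>

lemma nonneg_if_quadratic_nonneg_near_0:
  fixes a b :: real
  assumes "\<epsilon> > 0" and nonneg: "\<And>\<tau>. 0 < \<tau> \<Longrightarrow> \<tau> < \<epsilon> \<Longrightarrow> 0 \<le> \<tau> * a + \<tau>\<^sup>2 * b"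
  shows "0 \<le> a"
proof -
  have "((\<lambda>\<tau>. a + \<tau> * b) \<longlongrightarrow> a + 0 * b) (at_right 0)"
    by (intro tendsto_intros)
  moreover have "\<forall>\<^sub>F \<tau> in at_right 0. 0 \<le> a + \<tau> * b"
  proof -
    have "0 \<le> a + \<tau> * b" if "0 < \<tau>" "\<tau> < \<epsilon>" for \<tau>
    proof -
      have "0 \<le> \<tau> * (a + \<tau> * b)"
        using nonneg[OF that] by (simp add: algebra_simps power2_eq_square)
      then show ?thesis
        using that by (simp add: zero_le_mult_iff)
    qed
    then show ?thesis
      using \<open>\<epsilon> > 0\<close> by (auto simp: eventually_at_right_field)
  qed
  ultimately show ?thesis
    by (metis add_0_right mult_zero_left tendsto_lowerbound trivial_limit_at_right_real)
qed

text \<open>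
  Comparing the subgradient inequalities at both ends proves the bound with \<open>L\<close> in place of
  \<open>L / 2\<close>. A bound with constant \<open>c\<close>, used on both halves of the segment, yields one with
  constant \<open>c / 2 + L / 4\<close>; the fixed point of this iteration is \<open>L / 2\<close>. This avoids
  differentiating \<open>h\<close> along the segment.
\<close>

lemma convex_quadratic_upper_bound:
  fixes h :: "'a::real_inner \<Rightarrow> real"
  assumes sub: "\<And>x y. h y \<ge> h x + D x \<bullet> (y - x)"
    and lip: "\<And>x y. norm (D x - D y) \<le> L * norm (x - y)"
  shows "h y \<le> h x + D x \<bullet> (y - x) + L / 2 * (norm (y - x))\<^sup>2"
proof -
  have cs: "(D y - D x) \<bullet> (y - x) \<le> L * (norm (y - x))\<^sup>2" for x y
  proof -
    have "(D y - D x) \<bullet> (y - x) \<le> norm (D y - D x) * norm (y - x)"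
      by (rule norm_cauchy_schwarz)
    also have "\<dots> \<le> L * norm (y - x) * norm (y - x)"
      by (intro mult_right_mono lip) simp
    finally show ?thesis by (simp add: power2_eq_square)
  qed
  have bound: "h y \<le> h x + D x \<bullet> (y - x) + (L / 2 + L / 2 * (1/2) ^ n) * (norm (y - x))\<^sup>2"
    for n x y
  proof (induction n arbitrary: x y)
    case 0
    have "h x \<ge> h y + D y \<bullet> (x - y)" by (rule sub)
    with cs[of y x] show ?case by (simp add: algebra_simps inner_diff_left inner_diff_right)
  next
    case (Suc n)
    define d where "d = (1/2) *\<^sub>R (y - x)"
    define m where "m = x + d"
    define c where "c = L / 2 + L / 2 * (1/2) ^ n"
    have y: "y = m + d" "y - x = 2 *\<^sub>R d"
      unfolding m_def d_def by (auto simp: scaleR_2[symmetric] algebra_simps)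
    have 1: "h y \<le> h m + D m \<bullet> d + c * (norm d)\<^sup>2"
      using Suc[of y m] y by (simp add: c_def)
    have 2: "h m \<le> h x + D x \<bullet> d + c * (norm d)\<^sup>2"
      using Suc[of m x] by (simp add: m_def c_def)
    have 3: "D m \<bullet> d - D x \<bullet> d \<le> L * (norm d)\<^sup>2"
      using cs[of m x] by (simp add: m_def inner_diff_left)
    have "h y \<le> h x + 2 * (D x \<bullet> d) + (2 * c + L) * (norm d)\<^sup>2"
      using 1 2 3 by (simp add: algebra_simps)
    also have "\<dots> = h x + D x \<bullet> (y - x) + (L / 2 + L / 2 * (1/2) ^ Suc n) * (norm (y - x))\<^sup>2"
      unfolding y(2) by (simp add: c_def power_mult_distrib algebra_simps)
    finally show ?case .
  qed
  have "(\<lambda>n. h x + D x \<bullet> (y - x) + (L / 2 + L / 2 * (1/2) ^ n) * (norm (y - x))\<^sup>2)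
    \<longlonglongrightarrow> h x + D x \<bullet> (y - x) + (L / 2 + L / 2 * 0) * (norm (y - x))\<^sup>2"
    by (intro tendsto_intros LIMSEQ_power_zero) simp
  then show ?thesis
    using bound by (auto intro: LIMSEQ_le_const)
qed

text \<open>
  The function \<open>\<lambda>z. h z - D x \<bullet> z\<close> is minimal at \<open>x\<close>, and a gradient step of length \<open>1 / L\<close>
  from \<open>y\<close> decreases it by at least \<open>1 / (2 * L) * (norm (D y - D x))\<^sup>2\<close>.
\<close>

lemma convex_gradient_lower_bound:
  fixes h :: "'a::real_inner \<Rightarrow> real"
  assumes "L > 0"
    and sub: "\<And>x y. h y \<ge> h x + D x \<bullet> (y - x)"
    and lip: "\<And>x y. norm (D x - D y) \<le> L * norm (x - y)"
  shows "h y \<ge> h x + D x \<bullet> (y - x) + 1 / (2 * L) * (norm (D y - D x))\<^sup>2"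
proof -
  define v where "v = D y - D x"
  define w where "w = y - (1 / L) *\<^sub>R v"
  have up: "h w \<le> h y + D y \<bullet> (w - y) + L / 2 * (norm (w - y))\<^sup>2"
    by (rule convex_quadratic_upper_bound[OF sub lip])
  have "(norm (w - y))\<^sup>2 = (norm v)\<^sup>2 / L\<^sup>2"
    using \<open>L > 0\<close> by (simp add: w_def power_divide)
  then have q: "L / 2 * (norm (w - y))\<^sup>2 = 1 / (2 * L) * (norm v)\<^sup>2"
    using \<open>L > 0\<close> by (simp add: field_simps power2_eq_square)
  have "D y \<bullet> (w - y) - D x \<bullet> (w - y) = v \<bullet> (w - y)"
    by (simp add: v_def inner_diff_left)
  then have "D y \<bullet> (w - y) - D x \<bullet> (w - y) = - (1 / L) * (norm v)\<^sup>2"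
    by (simp add: w_def power2_norm_eq_inner)
  moreover have "- (1 / L) * (norm v)\<^sup>2 + 1 / (2 * L) * (norm v)\<^sup>2 = - (1 / (2 * L) * (norm v)\<^sup>2)"
    using \<open>L > 0\<close> by (simp add: field_simps)
  moreover have "D x \<bullet> (w - x) = D x \<bullet> (w - y) + D x \<bullet> (y - x)"
    by (simp add: inner_diff_right)
  ultimately show ?thesis
    using up q sub[of x w] unfolding v_def by linarith
qed

section \<open>Proximal subgradients of a difference of convex functions\<close>

definition prox_subdiff :: "('a::real_inner \<Rightarrow> real) \<Rightarrow> 'a \<Rightarrow> 'a set" where
  "prox_subdiff F y = {\<xi>. \<exists>k \<delta>. \<delta> > 0 \<and>
     (\<forall>x\<in>ball y \<delta>. F x \<ge> F y + \<xi> \<bullet> (x - y) - k * (norm (x - y))\<^sup>2)}"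

text \<open>
  For continuous \<open>F\<close> this is the usual limiting subdifferential; in general, convergence of
  the values of \<open>F\<close> would have to be required too. As an intersection of closures it is
  visibly closed, which separation from its convex hull depends on.
\<close>

definition limiting_prox_subdiff :: "('a::real_inner \<Rightarrow> real) \<Rightarrow> 'a \<Rightarrow> 'a set" where
  "limiting_prox_subdiff F x = (\<Inter>\<epsilon>\<in>{0<..}. closure (\<Union>y\<in>ball x \<epsilon>. prox_subdiff F y))"

text \<open>
  If \<open>k\<close> is large, a minimiser of \<open>F x + k * (norm (x - z))\<^sup>2\<close> over the closed ball lies in its
  interior, and the penalty turns into a quadratic minorant of \<open>F\<close> there.
\<close>

lemma prox_subdiff_dense:
  fixes F :: "'a::euclidean_space \<Rightarrow> real"
  assumes cont: "continuous_on UNIV F" and "r > 0"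
  obtains y \<xi> where "y \<in> ball z r" "\<xi> \<in> prox_subdiff F y"
proof -
  have cont': "continuous_on (cball z r) F"
    using cont continuous_on_subset by blast
  have ne: "cball z r \<noteq> {}" using \<open>r > 0\<close> by simp
  obtain m where m: "m \<in> cball z r" "\<And>x. x \<in> cball z r \<Longrightarrow> F m \<le> F x"
    using continuous_attains_inf[OF compact_cball ne cont'] by blast
  \<comment> \<open>On the sphere the penalty \<open>k * r\<^sup>2\<close> exceeds any possible decrease of \<open>F\<close>.\<close>
  define k where "k = (F z - F m + 1) / r\<^sup>2"
  have "F m \<le> F z" using m(2)[of z] \<open>r > 0\<close> by simp
  then have "k > 0" using \<open>r > 0\<close> by (simp add: k_def)
  have kr: "k * r\<^sup>2 = F z - F m + 1" using \<open>r > 0\<close> by (simp add: k_def)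
  have "continuous_on (cball z r) (\<lambda>x. F x + k * (norm (x - z))\<^sup>2)"
    by (intro continuous_intros cont')
  from continuous_attains_inf[OF compact_cball ne this] obtain y
    where y: "y \<in> cball z r"
      and ymin: "\<And>x. x \<in> cball z r \<Longrightarrow> F y + k * (norm (y - z))\<^sup>2 \<le> F x + k * (norm (x - z))\<^sup>2"
    by blast
  have "k * (norm (y - z))\<^sup>2 < k * r\<^sup>2"
    using ymin[of z] m(2)[OF y] \<open>r > 0\<close> kr by simp
  then have "norm (y - z) < r"
    using \<open>k > 0\<close> \<open>r > 0\<close> by (simp add: power_less_imp_less_base)
  then have yb: "y \<in> ball z r" by (simp add: dist_norm norm_minus_commute)
  have "- (2 * k) *\<^sub>R (y - z) \<in> prox_subdiff F y"
    unfolding prox_subdiff_def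
  proof (intro CollectI exI conjI ballI)
    show "r - dist z y > 0" using yb by simp
    fix x assume "x \<in> ball y (r - dist z y)"
    then have "x \<in> cball z r"
      using dist_triangle[of z x y] by simp
    from ymin[OF this]
    have "F x \<ge> F y + k * (norm (y - z))\<^sup>2 - k * (norm (x - z))\<^sup>2" by simp
    moreover have "(norm (x - z))\<^sup>2 = (norm (y - z))\<^sup>2 + 2 * ((y - z) \<bullet> (x - y)) + (norm (x - y))\<^sup>2"
      unfolding power2_norm_eq_inner by (simp add: algebra_simps inner_commute)
    ultimately show "F x \<ge> F y + (- (2 * k) *\<^sub>R (y - z)) \<bullet> (x - y) - k * (norm (x - y))\<^sup>2"
      by (simp add: algebra_simps)
  qed
  with yb show thesis by (rule that)
qed

text \<open>
  A proximal subgradient of \<open>A - B\<close> together with a quadratic upper bound for \<open>A\<close> bounds \<open>B\<close>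
  from above, to first order, by an affine function touching it at \<open>y\<close>. A convex function is
  then differentiable at \<open>y\<close>: the upper bound at \<open>y - \<tau> v\<close> and convexity between \<open>y - \<tau> v\<close>
  and \<open>y + \<tau> v\<close> give the matching lower bound in direction \<open>v\<close>.
\<close>

lemma subgradient_of_prox_subgradient_diff:
  fixes A B :: "'a::real_inner \<Rightarrow> real"
  assumes conv: "convex_on UNIV B"
    and up: "\<And>x. A x \<le> A y + u \<bullet> (x - y) + K * (norm (x - y))\<^sup>2"
    and \<xi>: "\<xi> \<in> prox_subdiff (\<lambda>x. A x - B x) y"
  shows "B x \<ge> B y + (u - \<xi>) \<bullet> (x - y)"
proof -
  obtain k \<delta> where "\<delta> > 0" and
    k: "\<And>x. x \<in> ball y \<delta> \<Longrightarrow> A x - B x \<ge> A y - B y + \<xi> \<bullet> (x - y) - k * (norm (x - y))\<^sup>2"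
    using \<xi> unfolding prox_subdiff_def by blast
  define v where "v = x - y"
  define c where "c = (u - \<xi>) \<bullet> v"
  define N where "N = (K + k) * (norm v)\<^sup>2"
  have "0 \<le> B x - B y - c"
  proof (rule nonneg_if_quadratic_nonneg_near_0)
    show "min 1 (\<delta> / (norm v + 1)) > 0"
      using \<open>\<delta> > 0\<close> by (simp add: add_nonneg_pos)
    fix \<tau> :: real assume \<tau>: "0 < \<tau>" "\<tau> < min 1 (\<delta> / (norm v + 1))"
    then have "\<tau> * (norm v + 1) < \<delta>"
      by (simp add: pos_less_divide_eq add_nonneg_pos)
    then have "\<tau> * norm v < \<delta>"
      using \<tau> by (simp add: algebra_simps)
    then have "y - \<tau> *\<^sub>R v \<in> ball y \<delta>"
      using \<tau> by (simp add: dist_norm)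
    from k[OF this] up[of "y - \<tau> *\<^sub>R v"]
    have minus: "B (y - \<tau> *\<^sub>R v) \<le> B y - \<tau> * c + \<tau>\<^sup>2 * N"
      by (simp add: c_def N_def inner_diff_left power_mult_distrib algebra_simps)
    have "B ((1 - \<tau>) *\<^sub>R y + \<tau> *\<^sub>R x) \<le> (1 - \<tau>) * B y + \<tau> * B x"
      using convex_onD[OF conv, of \<tau> y x] \<tau> by simp
    then have plus: "B (y + \<tau> *\<^sub>R v) \<le> (1 - \<tau>) * B y + \<tau> * B x"
      by (simp add: v_def algebra_simps)
    have "B ((1 - 1/2) *\<^sub>R (y - \<tau> *\<^sub>R v) + (1/2) *\<^sub>R (y + \<tau> *\<^sub>R v))
      \<le> (1 - 1/2) * B (y - \<tau> *\<^sub>R v) + 1/2 * B (y + \<tau> *\<^sub>R v)"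
      by (intro convex_onD[OF conv]) auto
    moreover have "(1 - 1/2) *\<^sub>R (y - \<tau> *\<^sub>R v) + (1/2) *\<^sub>R (y + \<tau> *\<^sub>R v) = y"
      by (simp add: algebra_simps flip: scaleR_add_left)
    ultimately have "2 * B y \<le> B (y - \<tau> *\<^sub>R v) + B (y + \<tau> *\<^sub>R v)" by simp
    with minus plus show "0 \<le> \<tau> * (B x - B y - c) + \<tau>\<^sup>2 * N"
      by (simp add: algebra_simps)
  qed
  then show ?thesis by (simp add: c_def v_def)
qed

text \<open>A unit step along a subgradient \<open>h\<close> raises \<open>B\<close> by at least \<open>norm h\<close>.\<close>

lemma subgradients_locally_bounded:
  fixes B :: "'a::euclidean_space \<Rightarrow> real"
  assumes cont: "continuous_on UNIV B"
  obtains M where "\<And>y h. y \<in> ball x 1 \<Longrightarrow> (\<And>w. B w \<ge> B y + h \<bullet> (w - y)) \<Longrightarrow> norm h \<le> M"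
proof -
  have "compact (B ` cball x 2)"
    by (intro compact_continuous_image continuous_on_subset[OF cont]) auto
  then have "bounded (B ` cball x 2)" by (rule compact_imp_bounded)
  then obtain c where "\<forall>b\<in>B ` cball x 2. norm b \<le> c"
    unfolding bounded_iff by blast
  then have c: "\<bar>B w\<bar> \<le> c" if "w \<in> cball x 2" for w
    using that by simp
  show thesis
  proof (rule that)
    fix y h assume y: "y \<in> ball x 1" and h: "\<And>w. B w \<ge> B y + h \<bullet> (w - y)"
    let ?w = "y + sgn h"
    have "dist x ?w \<le> dist x y + dist y ?w" by (rule dist_triangle)
    moreover have "dist y ?w \<le> 1" by (simp add: dist_norm norm_sgn)
    ultimately have "?w \<in> cball x 2" using y by simp
    moreover have "y \<in> cball x 2" using y by simp
    moreover have "h \<bullet> sgn h = norm h"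
      by (cases "h = 0") (simp_all add: sgn_div_norm power2_norm_eq_inner[symmetric] power2_eq_square)
    ultimately show "norm h \<le> 2 * c"
      using h[of ?w] c[of ?w] c[of y] by simp
  qed
qed

text \<open>
  For \<open>A = 0\<close> this is, up to sign, the nontrivial half of the fact that the subdifferential of a
  finite convex function is the convex hull of limits of its gradients at nearby points. The
  gradients are those at the dense set of points where \<open>A - B\<close> has a proximal subgradient. In
  each direction \<open>d\<close>, suitable limits of them lie on the correct side of \<open>D x - g\<close>, by
  monotonicity; compactness of the set of limits allows strict separation, and hence
  a contradiction.
\<close>

lemma gradient_minus_subgradient_in_hull:
  fixes A B :: "'a::euclidean_space \<Rightarrow> real"
  assumes contA: "continuous_on UNIV A" and contD: "continuous_on UNIV D"
    and up: "\<And>x y. A y \<le> A x + D x \<bullet> (y - x) + K * (norm (y - x))\<^sup>2"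
    and conv: "convex_on UNIV B"
    and g: "\<And>w. B w \<ge> B x + g \<bullet> (w - x)"
  shows "D x - g \<in> convex hull (limiting_prox_subdiff (\<lambda>x. A x - B x) x)"
proof (rule ccontr)
  define F where "F = (\<lambda>x. A x - B x)"
  let ?S = "limiting_prox_subdiff F x"
  assume "D x - g \<notin> convex hull (limiting_prox_subdiff (\<lambda>x. A x - B x) x)"
  then have notin: "D x - g \<notin> convex hull ?S" by (simp add: F_def)
  have contB: "continuous_on UNIV B"
    by (rule convex_on_continuous[OF open_UNIV conv])
  have contF: "continuous_on UNIV F"
    unfolding F_def by (intro continuous_intros contA contB)
  have subB: "B w \<ge> B y + (D y - \<xi>) \<bullet> (w - y)" if "\<xi> \<in> prox_subdiff F y" for y \<xi> w
    by (rule subgradient_of_prox_subgradient_diff[OF conv up that[unfolded F_def]])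
  obtain M where M: "\<And>y h. y \<in> ball x 1 \<Longrightarrow> (\<And>w. B w \<ge> B y + h \<bullet> (w - y)) \<Longrightarrow> norm h \<le> M"
    using subgradients_locally_bounded[OF contB] by blast
  have "bounded (D ` cball x 1)"
    by (intro compact_imp_bounded compact_continuous_image continuous_on_subset[OF contD]) auto
  then obtain c where "\<forall>v\<in>D ` cball x 1. norm v \<le> c"
    unfolding bounded_iff by blast
  then have c: "norm (D y) \<le> c" if "y \<in> cball x 1" for y
    using that by simp
  have \<xi>_bound: "norm \<xi> \<le> M + c" if "y \<in> ball x 1" "\<xi> \<in> prox_subdiff F y" for y \<xi>
  proof -
    have "norm (D y - \<xi>) \<le> M" using M[OF that(1)] subB[OF that(2)] by blast
    moreover have "norm (D y) \<le> c" using that c by simp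
    ultimately show ?thesis
      using norm_triangle_ineq4[of "D y" "D y - \<xi>"] by simp
  qed
  have "closed ?S"
    unfolding limiting_prox_subdiff_def by (intro closed_INT ballI closed_closure)
  moreover have "bounded ?S"
  proof (rule bounded_subset)
    show "bounded (closure (\<Union>y\<in>ball x 1. prox_subdiff F y))"
      using \<xi>_bound by (intro bounded_closure boundedI[of _ "M + c"]) blast
    show "?S \<subseteq> closure (\<Union>y\<in>ball x 1. prox_subdiff F y)"
      unfolding limiting_prox_subdiff_def by (rule INF_lower) simp
  qed
  ultimately have "compact ?S" by (simp add: compact_eq_bounded_closed)
  then have "closed (convex hull ?S)"
    by (intro compact_imp_closed compact_convex_hull)
  from separating_hyperplane_closed_point[OF convex_convex_hull this notin]
  obtain d b where d1: "d \<bullet> (D x - g) < b" and d: "\<forall>\<xi>\<in>convex hull ?S. b < d \<bullet> \<xi>"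
    by blast
  have d2: "b < d \<bullet> \<xi>" if "\<xi> \<in> ?S" for \<xi>
    using d hull_inc[OF that] by (rule bspec)
  define \<epsilon> where "\<epsilon> n = inverse (real (Suc n))" for n
  \<comment> \<open>Points within \<open>(t n)\<^sup>2\<close> of \<open>x + t n *\<^sub>R d\<close> approach \<open>x\<close> from direction \<open>d\<close>; the
      scaling keeps them within \<open>\<epsilon> n\<close> of \<open>x\<close>.\<close>
  define t where "t n = \<epsilon> n / (norm d + 2)" for n
  have \<epsilon>: "0 < \<epsilon> n" "\<epsilon> n \<le> 1" for n
    by (auto simp: \<epsilon>_def inverse_eq_divide)
  have \<epsilon>_lim: "\<epsilon> \<longlonglongrightarrow> 0"
    unfolding \<epsilon>_def by (rule LIMSEQ_inverse_real_of_nat)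
  have t: "0 < t n" for n
    using \<epsilon> by (simp add: t_def add_nonneg_pos)
  have t\<epsilon>: "t n * (norm d + 2) = \<epsilon> n" for n
    using norm_ge_zero[of d] by (simp add: t_def add_nonneg_eq_0_iff)
  have t1: "t n \<le> 1" for n
  proof -
    have "t n * 1 \<le> t n * (norm d + 2)" using t[of n] by (intro mult_left_mono) auto
    with t\<epsilon>[of n] \<epsilon>(2)[of n] show ?thesis by simp
  qed
  have "t \<longlonglongrightarrow> 0 / (norm d + 2)"
    unfolding t_def by (intro tendsto_intros \<epsilon>_lim) (simp add: add_nonneg_eq_0_iff)
  then have t_lim: "t \<longlonglongrightarrow> 0" by simp
  have "\<exists>y \<xi>. y \<in> ball (x + t n *\<^sub>R d) ((t n)\<^sup>2) \<and> \<xi> \<in> prox_subdiff F y" for n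
  proof -
    have "(t n)\<^sup>2 > 0" using t[of n] by simp
    then obtain y \<xi> where "y \<in> ball (x + t n *\<^sub>R d) ((t n)\<^sup>2)" "\<xi> \<in> prox_subdiff F y"
      by (rule prox_subdiff_dense[OF contF])
    then show ?thesis by blast
  qed
  then obtain y \<xi> where y: "\<And>n. y n \<in> ball (x + t n *\<^sub>R d) ((t n)\<^sup>2)"
    and \<xi>: "\<And>n. \<xi> n \<in> prox_subdiff F (y n)" by metis
  have y_near: "dist (y n) (x + t n *\<^sub>R d) < (t n)\<^sup>2" for n
    using y[of n] by (simp add: dist_commute)
  have y_ball: "y n \<in> ball x (\<epsilon> n)" for n
  proof -
    have "dist x (y n) \<le> dist x (x + t n *\<^sub>R d) + dist (x + t n *\<^sub>R d) (y n)"
      by (rule dist_triangle)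
    also have "\<dots> < t n * norm d + (t n)\<^sup>2"
      using y_near[of n] t[of n] by (simp add: dist_norm norm_minus_commute)
    also have "\<dots> \<le> t n * norm d + t n * 2"
      using t[of n] t1[of n] by (simp add: power2_eq_square mult_left_mono)
    also have "\<dots> = \<epsilon> n" using t\<epsilon>[of n] by (simp add: algebra_simps)
    finally show ?thesis by simp
  qed
  then have y_ball1: "y n \<in> ball x 1" for n
    using \<epsilon>(2)[of n] subset_ball by blast
  have y_lim: "y \<longlonglongrightarrow> x"
  proof (rule metric_LIMSEQ_I)
    fix r :: real assume "r > 0"
    from order_tendstoD(2)[OF \<epsilon>_lim this] obtain N where N: "\<And>n. n \<ge> N \<Longrightarrow> \<epsilon> n < r"
      by (auto simp: eventually_sequentially)
    have "dist (y n) x < r" if "n \<ge> N" for n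
      using y_ball[of n] N[OF that] by (simp add: dist_commute)
    then show "\<exists>N. \<forall>n\<ge>N. dist (y n) x < r" by blast
  qed
  have main: "d \<bullet> \<xi> n \<le> d \<bullet> D (y n) - d \<bullet> g + (M + norm g) * t n" for n
  proof -
    define h where "h = D (y n) - \<xi> n"
    define e where "e = y n - (x + t n *\<^sub>R d)"
    have hsub: "B w \<ge> B (y n) + h \<bullet> (w - y n)" for w
      unfolding h_def by (rule subB[OF \<xi>])
    have "norm h \<le> M" using M[OF y_ball1 hsub] .
    then have hg: "norm (h - g) \<le> M + norm g"
      using norm_triangle_ineq4[of h g] by simp
    have "norm e \<le> (t n)\<^sup>2"
      using y_near[of n] by (simp add: e_def dist_norm)
    \<comment> \<open>Monotonicity of the subdifferential of \<open>B\<close>, to be divided by \<open>t n\<close>.\<close>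
    have "0 \<le> (h - g) \<bullet> (y n - x)"
      using hsub[of x] g[of "y n"] by (simp add: inner_diff_left inner_diff_right)
    also have "\<dots> = t n * ((h - g) \<bullet> d) + (h - g) \<bullet> e"
      by (simp add: e_def inner_diff_right inner_add_right)
    also have "(h - g) \<bullet> e \<le> norm (h - g) * norm e" by (rule norm_cauchy_schwarz)
    also have "\<dots> \<le> (M + norm g) * (t n)\<^sup>2"
      using hg \<open>norm e \<le> (t n)\<^sup>2\<close> by (intro mult_mono) (auto intro: order_trans[OF norm_ge_zero])
    finally have "0 \<le> t n * ((h - g) \<bullet> d + (M + norm g) * t n)"
      by (simp add: algebra_simps power2_eq_square)
    then have "0 \<le> (h - g) \<bullet> d + (M + norm g) * t n"
      using t[of n] by (simp add: zero_le_mult_iff)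
    then show ?thesis
      by (simp add: h_def inner_diff_left inner_diff_right inner_commute)
  qed
  have "bounded (range \<xi>)"
    using \<xi>_bound[OF y_ball1 \<xi>] by (intro boundedI) auto
  then obtain \<xi>' s where s: "strict_mono s" and \<xi>': "(\<xi> \<circ> s) \<longlonglongrightarrow> \<xi>'"
    using bounded_imp_convergent_subsequence by blast
  have "\<xi>' \<in> ?S"
    unfolding limiting_prox_subdiff_def
  proof (intro INT_I)
    fix r :: real assume "r \<in> {0<..}"
    then have "r > 0" by simp
    have "(\<epsilon> \<circ> s) \<longlonglongrightarrow> 0" by (rule LIMSEQ_subseq_LIMSEQ[OF \<epsilon>_lim s])
    then have "\<forall>\<^sub>F n in sequentially. (\<epsilon> \<circ> s) n < r"
      using \<open>r > 0\<close> by (rule order_tendstoD)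
    then have ev: "\<forall>\<^sub>F n in sequentially. (\<xi> \<circ> s) n \<in> closure (\<Union>y\<in>ball x r. prox_subdiff F y)"
    proof (rule eventually_mono)
      fix n assume "(\<epsilon> \<circ> s) n < r"
      then have "y (s n) \<in> ball x r" using y_ball[of "s n"] by simp
      with \<xi>[of "s n"] show "(\<xi> \<circ> s) n \<in> closure (\<Union>y\<in>ball x r. prox_subdiff F y)"
        using closure_subset by fastforce
    qed
    show "\<xi>' \<in> closure (\<Union>y\<in>ball x r. prox_subdiff F y)"
      by (rule Lim_in_closed_set[OF closed_closure ev _ \<xi>']) simp
  qed
  then have "b < d \<bullet> \<xi>'" by (rule d2)
  have D_lim: "(\<lambda>n. D (y n)) \<longlonglongrightarrow> D x"
    using continuous_on_tendsto_compose[OF contD y_lim] by simp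
  have "(\<lambda>n. d \<bullet> D (y n) - d \<bullet> g + (M + norm g) * t n) \<longlonglongrightarrow> d \<bullet> D x - d \<bullet> g + (M + norm g) * 0"
    by (intro tendsto_intros D_lim t_lim)
  from LIMSEQ_subseq_LIMSEQ[OF this s]
  have "(\<lambda>n. d \<bullet> D (y (s n)) - d \<bullet> g + (M + norm g) * t (s n)) \<longlonglongrightarrow> d \<bullet> (D x - g)"
    by (simp add: o_def inner_diff_right)
  moreover have "(\<lambda>n. d \<bullet> \<xi> (s n)) \<longlonglongrightarrow> d \<bullet> \<xi>'"
    using \<xi>' by (intro tendsto_intros) (simp add: o_def)
  ultimately have "d \<bullet> \<xi>' \<le> d \<bullet> (D x - g)"
    using main by (intro LIMSEQ_le) blast+
  with \<open>b < d \<bullet> \<xi>'\<close> d1 show False by simp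
qed

section \<open>Smooth closed convex functions are finite everywhere\<close>

text \<open>
  The point \<open>p\<close> minimises \<open>h x + \<rho> / 2 * (norm (x - z))\<^sup>2\<close>. The minimum is sought over the
  epigraph, where the objective is continuous and closedness of \<open>h\<close> is closedness of the
  feasible set; the affine minorant given by \<open>g0\<close> makes the sublevel sets bounded.
\<close>

lemma prox_point:
  fixes h :: "real^'n \<Rightarrow> ereal"
  assumes closed: "closed_fun h" and proper: "proper_fun h" and conv: "convex_fun h"
    and g0: "g0 \<in> subdiff h x0" and "\<rho> > 0"
  obtains p where "\<rho> *\<^sub>R (z - p) \<in> subdiff h p"
proof -
  have ninf: "h x \<noteq> -\<infinity>" for x using proper by (simp add: proper_fun_def)
  have fin: "h x0 < \<infinity>" using g0 by (simp add: subdiff_def)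
  then obtain t0 where t0: "h x0 = ereal t0" using ninf[of x0] by (cases "h x0") auto
  have g0': "ereal t0 + ereal (g0 \<bullet> (y - x0)) \<le> h y" for y
    using g0 by (simp add: subdiff_def t0)
  define q where "q xt = snd xt + \<rho> / 2 * (norm (fst xt - z))\<^sup>2" for xt :: "(real^'n) \<times> real"
  define c where "c = q (x0, t0)"
  define S where "S = ext_epigraph h \<inter> {xt. q xt \<le> c}"
  have qcont: "continuous_on T q" for T
    unfolding q_def by (intro continuous_intros)
  have "(x0, t0) \<in> S" by (simp add: S_def c_def ext_epigraph_def t0)
  have "closed S"
    unfolding S_def using closed
    by (intro closed_Int closed_Collect_le qcont continuous_intros) (simp_all add: closed_fun_def)
  moreover have "bounded S"
  proof -
    define C where "C = \<bar>c - t0 - g0 \<bullet> (z - x0)\<bar>"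
    define R where "R = 1 + 2 * (C + norm g0) / \<rho>"
    have R: "norm (x - z) \<le> R \<and> t0 + g0 \<bullet> (x - x0) \<le> t \<and> t \<le> c" if "(x, t) \<in> S" for x t
    proof -
      have "h x \<le> ereal t" and le: "q (x, t) \<le> c" using that by (auto simp: S_def ext_epigraph_def)
      with g0'[of x] have "ereal t0 + ereal (g0 \<bullet> (x - x0)) \<le> ereal t" by (meson order_trans)
      then have lo: "t0 + g0 \<bullet> (x - x0) \<le> t" by simp
      have le': "t + \<rho> / 2 * (norm (x - z))\<^sup>2 \<le> c" using le by (simp add: q_def)
      have "g0 \<bullet> (x - x0) = g0 \<bullet> (x - z) + g0 \<bullet> (z - x0)" by (simp add: inner_diff_right)
      moreover have "- (g0 \<bullet> (x - z)) \<le> norm g0 * norm (x - z)"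
        using Cauchy_Schwarz_ineq2[of g0 "x - z"] by simp
      ultimately have quad: "\<rho> / 2 * (norm (x - z))\<^sup>2 \<le> C + norm g0 * norm (x - z)"
        using lo le' abs_ge_self[of "c - t0 - g0 \<bullet> (z - x0)"] unfolding C_def by linarith
      have "norm (x - z) \<le> R"
      proof (cases "norm (x - z) \<le> 1")
        case True
        moreover have "0 \<le> 2 * (C + norm g0) / \<rho>" using \<open>\<rho> > 0\<close> by (simp add: C_def)
        ultimately show ?thesis by (simp add: R_def)
      next
        case False
        then have "C \<le> C * norm (x - z)"
          using mult_left_mono[of 1 "norm (x - z)" C] by (simp add: C_def)
        with quad have "(\<rho> / 2 * norm (x - z)) * norm (x - z) \<le> (C + norm g0) * norm (x - z)"
          by (simp add: power2_eq_square algebra_simps)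
        then have "\<rho> / 2 * norm (x - z) \<le> C + norm g0"
          by (rule mult_right_le_imp_le) (use False in linarith)
        then have "norm (x - z) \<le> 2 * (C + norm g0) / \<rho>"
          using \<open>\<rho> > 0\<close> by (simp add: field_simps)
        then show ?thesis by (simp add: R_def)
      qed
      moreover have "0 \<le> \<rho> / 2 * (norm (x - z))\<^sup>2" using \<open>\<rho> > 0\<close> by simp
      then have "t \<le> c" using le' by linarith
      ultimately show ?thesis using lo by simp
    qed
    have "S \<subseteq> cball z R \<times> {t0 - norm g0 * (R + norm (z - x0)) .. c}"
    proof clarify
      fix x t assume "(x, t) \<in> S"
      note R = R[OF this]
      have "norm (x - x0) \<le> R + norm (z - x0)"
        using norm_triangle_ineq[of "x - z" "z - x0"] R by simp
      then have "norm g0 * norm (x - x0) \<le> norm g0 * (R + norm (z - x0))"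
        by (intro mult_left_mono) auto
      then have "- (norm g0 * (R + norm (z - x0))) \<le> g0 \<bullet> (x - x0)"
        using Cauchy_Schwarz_ineq2[of g0 "x - x0"] by simp
      with R show "x \<in> cball z R \<and> t \<in> {t0 - norm g0 * (R + norm (z - x0)) .. c}"
        by (simp add: dist_norm norm_minus_commute)
    qed
    then show ?thesis
      by (rule bounded_subset[rotated]) (intro bounded_Times bounded_cball bounded_closed_interval)
  qed
  ultimately have "compact S" by (simp add: compact_eq_bounded_closed)
  from continuous_attains_inf[OF this _ qcont] \<open>(x0, t0) \<in> S\<close>
  obtain p s where ps: "(p, s) \<in> S" and min: "\<And>yt. yt \<in> S \<Longrightarrow> q (p, s) \<le> q yt"
    by fastforce
  have min_epi: "q (p, s) \<le> q yt" if "yt \<in> ext_epigraph h" for yt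
    using that min[of yt] ps by (cases "q yt \<le> c") (auto simp: S_def)
  have epi: "(p, s) \<in> ext_epigraph h" using ps by (simp add: S_def)
  then obtain s' where s': "h p = ereal s'" "s' \<le> s"
    using ninf[of p] by (cases "h p") (auto simp: ext_epigraph_def)
  have "q (p, s) \<le> q (p, s')" using s' by (intro min_epi) (simp add: ext_epigraph_def)
  then have hp: "h p = ereal s" using s' by (simp add: q_def)
  have "\<rho> *\<^sub>R (z - p) \<in> subdiff h p"
    unfolding subdiff_def
  proof (intro CollectI conjI allI)
    show "h p < \<infinity>" by (simp add: hp)
    fix y
    show "h y \<ge> h p + ereal (\<rho> *\<^sub>R (z - p) \<bullet> (y - p))"
    proof (cases "h y")
      case (real r)
      have "0 \<le> (r - s) - \<rho> * ((z - p) \<bullet> (y - p))"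
      proof (rule nonneg_if_quadratic_nonneg_near_0[of 1])
        fix \<tau> :: real assume \<tau>: "0 < \<tau>" "\<tau> < 1"
        have "(y, r) \<in> ext_epigraph h" by (simp add: ext_epigraph_def real)
        then have "(1 - \<tau>) *\<^sub>R (p, s) + \<tau> *\<^sub>R (y, r) \<in> ext_epigraph h"
          using conv epi \<tau> by (intro convexD) (auto simp: convex_fun_def)
        from min_epi[OF this]
        have *: "s + \<rho> / 2 * (norm (p - z))\<^sup>2
          \<le> (1 - \<tau>) * s + \<tau> * r + \<rho> / 2 * (norm ((p - z) + \<tau> *\<^sub>R (y - p)))\<^sup>2"
          by (simp add: q_def algebra_simps)
        define I where "I = (z - p) \<bullet> (y - p)"
        have eq: "(norm ((p - z) + \<tau> *\<^sub>R (y - p)))\<^sup>2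
          = (norm (p - z))\<^sup>2 - 2 * \<tau> * I + \<tau>\<^sup>2 * (norm (y - p))\<^sup>2"
          unfolding power2_norm_eq_inner I_def
          by (simp add: algebra_simps inner_commute power2_eq_square)
        show "0 \<le> \<tau> * ((r - s) - \<rho> * ((z - p) \<bullet> (y - p))) + \<tau>\<^sup>2 * (\<rho> / 2 * (norm (y - p))\<^sup>2)"
          using * unfolding eq I_def[symmetric] by (simp add: algebra_simps)
      qed simp
      then show ?thesis by (simp add: hp real)
    qed (use ninf in auto)
  qed
  then show thesis by (rule that)
qed

text \<open>
  Let \<open>p n\<close> be the proximal point of \<open>z\<close> with parameter \<open>l n > L\<close>. Its subgradient
  \<open>l n *\<^sub>R (z - p n)\<close> grows with slope \<open>l n\<close> in the distance from \<open>z\<close>, while smoothness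
  permits slope \<open>L\<close> only. Hence \<open>p n\<close> tends to \<open>z\<close> with bounded subgradients, and
  closedness of the epigraph turns a limit of these into a subgradient at \<open>z\<close>.
\<close>

lemma subdiff_nonempty_if_smooth:
  fixes h :: "real^'n \<Rightarrow> ereal"
  assumes closed: "closed_fun h" and proper: "proper_fun h" and conv: "convex_fun h"
    and smooth: "smooth_fun (ereal L) h" and "L > 0" and g0: "g0 \<in> subdiff h x0"
  shows "subdiff h z \<noteq> {}"
proof -
  have ninf: "h x \<noteq> -\<infinity>" for x using proper by (simp add: proper_fun_def)
  have lip: "norm (g1 - g2) \<le> L * norm (y1 - y2)"
    if "g1 \<in> subdiff h y1" "g2 \<in> subdiff h y2" for g1 g2 y1 y2
    using smooth that unfolding smooth_fun_def by fastforce
  define l where "l n = L + real (Suc n)" for n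
  have l: "l n > 0" for n using \<open>L > 0\<close> by (simp add: l_def add_pos_pos)
  have "\<exists>p. l n *\<^sub>R (z - p) \<in> subdiff h p" for n
    using prox_point[OF closed proper conv g0 l] by metis
  then obtain p where p: "\<And>n. l n *\<^sub>R (z - p n) \<in> subdiff h (p n)" by metis
  define G where "G n = l n *\<^sub>R (z - p n)" for n
  define C where "C = norm g0 + L * norm (z - x0)"
  have "C \<ge> 0" using \<open>L > 0\<close> by (simp add: C_def)
  have near: "norm (p n - z) \<le> C * inverse (real (Suc n))" for n
  proof -
    have tri: "norm (p n - x0) \<le> norm (p n - z) + norm (z - x0)"
      using norm_triangle_ineq[of "p n - z" "z - x0"] by simp
    have "l n * norm (p n - z) = norm (G n)"
      using l[of n] by (simp add: G_def norm_minus_commute)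
    also have "\<dots> \<le> norm g0 + norm (G n - g0)"
      using norm_triangle_ineq[of g0 "G n - g0"] by simp
    also have "\<dots> \<le> norm g0 + L * norm (p n - x0)"
      using lip[OF p[of n] g0] by (simp add: G_def)
    also have "\<dots> \<le> norm g0 + L * (norm (p n - z) + norm (z - x0))"
      using tri \<open>L > 0\<close> by simp
    finally have "real (Suc n) * norm (p n - z) \<le> C"
      by (simp add: l_def C_def algebra_simps)
    then show ?thesis by (simp add: field_simps)
  qed
  have p_lim: "p \<longlonglongrightarrow> z"
  proof -
    have "(\<lambda>n. C * inverse (real (Suc n))) \<longlonglongrightarrow> 0"
      by (rule tendsto_mult_right_zero[OF LIMSEQ_inverse_real_of_nat])
    then have "(\<lambda>n. p n - z) \<longlonglongrightarrow> 0"
      by (rule Lim_null_comparison[OF always_eventually[OF allI[OF near]]])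
    then show ?thesis by (rule LIM_zero_cancel)
  qed
  have "norm (G n) \<le> norm g0 + L * (C + norm (z - x0))" for n
  proof -
    have "norm (p n - z) \<le> C"
    proof -
      have "inverse (real (Suc n)) \<le> 1" by (simp add: inverse_le_1_iff)
      from mult_left_mono[OF this \<open>C \<ge> 0\<close>] near[of n] show ?thesis by linarith
    qed
    then have "norm (p n - x0) \<le> C + norm (z - x0)"
      using norm_triangle_ineq[of "p n - z" "z - x0"] by simp
    then have "L * norm (p n - x0) \<le> L * (C + norm (z - x0))" using \<open>L > 0\<close> by simp
    moreover have "norm (G n - g0) \<le> L * norm (p n - x0)"
      using lip[OF p[of n] g0] by (simp add: G_def)
    ultimately show ?thesis using norm_triangle_ineq[of g0 "G n - g0"] by simp
  qed
  then have "bounded (range G)" by (intro boundedI) auto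
  then obtain g s where s: "strict_mono s" and g: "(G \<circ> s) \<longlonglongrightarrow> g"
    using bounded_imp_convergent_subsequence by blast
  have ps: "(\<lambda>n. p (s n)) \<longlonglongrightarrow> z" using LIMSEQ_subseq_LIMSEQ[OF p_lim s] by (simp add: o_def)
  have gs: "(\<lambda>n. G (s n)) \<longlonglongrightarrow> g" using g by (simp add: o_def)
  \<comment> \<open>Reading the subgradient inequality at \<open>p n\<close> as membership in the epigraph allows passing
      to the limit, and shows that \<open>h z\<close> is finite.\<close>
  have below: "h z \<le> ereal (t - g \<bullet> (y - z))" if "h y = ereal t" for y t
  proof -
    have in_epi: "(p (s n), t - G (s n) \<bullet> (y - p (s n))) \<in> ext_epigraph h" for n
    proof -
      have "h (p (s n)) + ereal (G (s n) \<bullet> (y - p (s n))) \<le> h y"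
        using p[of "s n"] by (simp add: subdiff_def G_def)
      then have "h (p (s n)) + ereal (G (s n) \<bullet> (y - p (s n))) \<le> ereal t"
        by (simp only: that)
      then show ?thesis
        by (cases "h (p (s n))") (auto simp: ext_epigraph_def)
    qed
    have "(\<lambda>n. (p (s n), t - G (s n) \<bullet> (y - p (s n)))) \<longlonglongrightarrow> (z, t - g \<bullet> (y - z))"
      by (intro tendsto_intros ps gs)
    with closed in_epi have "(z, t - g \<bullet> (y - z)) \<in> ext_epigraph h"
      unfolding closed_fun_def by (rule closed_sequentially)
    then show ?thesis by (simp add: ext_epigraph_def)
  qed
  have "h x0 < \<infinity>" using g0 by (simp add: subdiff_def)
  then obtain t0 where "h x0 = ereal t0" using ninf[of x0] by (cases "h x0") auto
  from below[OF this] obtain hz where hz: "h z = ereal hz"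
    using ninf[of z] by (cases "h z") auto
  have "g \<in> subdiff h z"
    unfolding subdiff_def
  proof (intro CollectI conjI allI)
    show "h z < \<infinity>" by (simp add: hz)
    fix y
    show "h y \<ge> h z + ereal (g \<bullet> (y - z))"
      using below[of y] ninf[of y] hz by (cases "h y") auto
  qed
  then show ?thesis by blast
qed

lemma smooth_convex_gradient:
  fixes h :: "real^'n \<Rightarrow> ereal"
  assumes F: "h \<in> F_class \<mu> (ereal L)" and "L > 0" and ne: "subdiff h x0 \<noteq> {}"
  obtains A D where "\<And>x. h x = ereal (A x)"
    and "\<And>x y. A y \<ge> A x + D x \<bullet> (y - x)"
    and "\<And>x y. norm (D x - D y) \<le> L * norm (x - y)"
    and "\<And>x g. g \<in> subdiff h x \<Longrightarrow> g = D x"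
proof -
  have closed: "closed_fun h" and proper: "proper_fun h" and conv: "convex_fun h"
    and smooth: "smooth_fun (ereal L) h"
    using F by (auto simp: F_class_def)
  define A where "A x = real_of_ereal (h x)" for x
  define D where "D x = (SOME g. g \<in> subdiff h x)" for x
  have D: "D x \<in> subdiff h x" for x
  proof -
    obtain g0 where "g0 \<in> subdiff h x0" using ne by blast
    from subdiff_nonempty_if_smooth[OF closed proper conv smooth \<open>L > 0\<close> this, of x]
    show ?thesis unfolding D_def by (simp add: some_in_eq)
  qed
  have fin: "h x = ereal (A x)" for x
  proof -
    have "h x < \<infinity>" using D[of x] by (simp add: subdiff_def)
    moreover have "h x \<noteq> -\<infinity>" using proper by (simp add: proper_fun_def)
    ultimately show ?thesis unfolding A_def by (cases "h x") auto
  qed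
  have lip: "norm (g1 - g2) \<le> L * norm (y1 - y2)"
    if "g1 \<in> subdiff h y1" "g2 \<in> subdiff h y2" for g1 g2 y1 y2
    using smooth that unfolding smooth_fun_def by fastforce
  show thesis
  proof (rule that)
    show "h x = ereal (A x)" for x by (rule fin)
    show "A y \<ge> A x + D x \<bullet> (y - x)" for x y
    proof -
      have "h x + ereal (D x \<bullet> (y - x)) \<le> h y" using D[of x] by (simp add: subdiff_def)
      then show ?thesis by (simp add: fin)
    qed
    show "norm (D x - D y) \<le> L * norm (x - y)" for x y by (intro lip D)
    show "g = D x" if "g \<in> subdiff h x" for x g
      using lip[OF that D[of x]] by simp
  qed
qed

lemma convex_on_if_convex_fun:
  assumes "convex_fun h" and "\<And>x. h x = ereal (B x)"
  shows "convex_on UNIV B"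
proof -
  have "ext_epigraph h = epigraph UNIV B"
    using assms(2) by (auto simp: ext_epigraph_def epigraph_def)
  then show ?thesis
    using assms(1) convex_epigraph[of UNIV B] by (simp add: convex_fun_def)
qed

section \<open>From quadratic minorants to general subgradients\<close>

lemma regular_subdiff_if_quadratic_minorant:
  fixes f :: "real^'n \<Rightarrow> ereal"
  assumes "\<bar>f y\<bar> \<noteq> \<infinity>" and "\<delta> > 0"
    and minor: "\<And>x. x \<in> ball y \<delta> \<Longrightarrow> f x \<ge> f y + ereal (\<xi> \<bullet> (x - y) - k * (norm (x - y))\<^sup>2)"
  shows "\<xi> \<in> regular_subdiff f y"
proof -
  define r where "r x = - k * (norm (x - y))\<^sup>2" for x
  have "((\<lambda>x. - k * norm (x - y)) \<longlongrightarrow> - k * norm (y - y)) (at y)"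
    by (intro tendsto_intros)
  moreover have "\<forall>\<^sub>F x in at y. - k * norm (x - y) = r x / norm (x - y)"
    by (auto simp: eventually_at_filter r_def power2_eq_square)
  ultimately have "((\<lambda>x. r x / norm (x - y)) \<longlongrightarrow> 0) (at y)"
    by (simp add: filterlim_cong)
  moreover have "\<forall>\<^sub>F x in at y. norm (x - y) \<noteq> 0"
    by (auto simp: eventually_at_filter)
  ultimately have "r \<in> o[at y](\<lambda>x. norm (x - y))"
    by (intro smalloI_tendsto)
  moreover have "\<forall>\<^sub>F x in at y. f x \<ge> f y + ereal (\<xi> \<bullet> (x - y) + r x)"
    using \<open>\<delta> > 0\<close> minor by (auto simp: eventually_at r_def dist_commute intro!: exI[of _ \<delta>])
  ultimately show ?thesis
    using assms(1) unfolding regular_subdiff_def by blast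
qed

lemma regular_subset_general_subdiff: "regular_subdiff f x \<subseteq> general_subdiff f x"
proof
  fix g assume g: "g \<in> regular_subdiff f x"
  then have "\<bar>f x\<bar> \<noteq> \<infinity>" by (simp add: regular_subdiff_def)
  moreover have "\<exists>X G. X \<longlonglongrightarrow> x \<and> (\<lambda>i. f (X i)) \<longlonglongrightarrow> f x \<and>
      (\<forall>i. G i \<in> regular_subdiff f (X i)) \<and> G \<longlonglongrightarrow> g"
    using g by (intro exI[of _ "\<lambda>i::nat. x"] exI[of _ "\<lambda>i::nat. g"]) auto
  ultimately show "g \<in> general_subdiff f x" by (simp add: general_subdiff_def)
qed

lemma limiting_prox_subset_general_subdiff:
  fixes f :: "real^'n \<Rightarrow> ereal"
  assumes f: "\<And>x. f x = ereal (F x)" and cont: "continuous_on UNIV F"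
  shows "limiting_prox_subdiff F x \<subseteq> general_subdiff f x"
proof
  fix g assume g: "g \<in> limiting_prox_subdiff F x"
  define \<epsilon> where "\<epsilon> n = inverse (real (Suc n))" for n
  have \<epsilon>_lim: "\<epsilon> \<longlonglongrightarrow> 0"
    unfolding \<epsilon>_def by (rule LIMSEQ_inverse_real_of_nat)
  have "\<exists>y \<xi>. dist y x < \<epsilon> n \<and> \<xi> \<in> prox_subdiff F y \<and> dist \<xi> g < \<epsilon> n" for n
  proof -
    have "\<epsilon> n > 0" by (simp add: \<epsilon>_def)
    moreover from this have "g \<in> closure (\<Union>y\<in>ball x (\<epsilon> n). prox_subdiff F y)"
      using g by (simp add: limiting_prox_subdiff_def)
    ultimately show ?thesis
      unfolding closure_approachable by (fastforce simp: dist_commute)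
  qed
  then obtain y \<xi> where y: "\<And>n. dist (y n) x < \<epsilon> n"
    and \<xi>: "\<And>n. \<xi> n \<in> prox_subdiff F (y n)" "\<And>n. dist (\<xi> n) g < \<epsilon> n" by metis
  have lim: "u \<longlonglongrightarrow> v" if "\<And>n. dist (u n) v < \<epsilon> n" for u :: "nat \<Rightarrow> real^'n" and v
  proof -
    have "(\<lambda>n. dist (u n) v) \<longlonglongrightarrow> 0"
      by (rule tendsto_sandwich[OF _ _ tendsto_const \<epsilon>_lim])
        (use that in \<open>auto intro!: always_eventually less_imp_le\<close>)
    then show ?thesis by (rule tendsto_dist_iff[THEN iffD2])
  qed
  have y_lim: "y \<longlonglongrightarrow> x" and \<xi>_lim: "\<xi> \<longlonglongrightarrow> g"
    by (rule lim[OF y], rule lim[OF \<xi>(2)])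
  have "(\<lambda>n. F (y n)) \<longlonglongrightarrow> F x"
    using continuous_on_tendsto_compose[OF cont y_lim] by simp
  then have "(\<lambda>n. f (y n)) \<longlonglongrightarrow> f x" by (simp add: f)
  moreover have "\<xi> n \<in> regular_subdiff f (y n)" for n
    using \<xi>(1)[of n] unfolding prox_subdiff_def
    by (fastforce simp: f algebra_simps intro!: regular_subdiff_if_quadratic_minorant)
  ultimately show "g \<in> general_subdiff f x"
    using y_lim \<xi>_lim by (auto simp: general_subdiff_def f)
qed

section \<open>One step of the algorithm\<close>

theorem theorem5p1:
  fixes f1 f2 f :: "real^'n \<Rightarrow> ereal"
    and L1 L2 :: ereal and \<mu>1 \<mu>2 \<eta> fstar :: real
    and x1 x2 :: "real^'n"
  assumes "L1 > 0" and "L2 > 0" and "\<mu>1 \<ge> 0" and "\<mu>2 \<ge> 0"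
    and "L1 > ereal \<mu>2" and "L2 > ereal \<mu>1"
    and "L1 < \<infinity> \<or> L2 < \<infinity>"
    and "f1 \<in> F_class \<mu>1 L1" and "f2 \<in> F_class \<mu>2 L2"
    and "f = dc_diff f1 f2"
    and "lower_semicont f"
    and "\<forall>x. ereal fstar \<le> f x"
    and "ereal fstar < f x1"
    and "\<eta> > 0"
    and "PL_inequality f fstar \<eta> {x. f x \<le> f x1}"
    and "subdiff f1 x1 \<noteq> {}" and "subdiff f2 x1 \<noteq> {}"
    and "subdiff f1 x2 \<noteq> {}" and "subdiff f2 x2 \<noteq> {}"
    and "DCA_step f1 f2 x1 x2"
  shows "(f x2 - ereal fstar) / (f x1 - ereal fstar)
           \<le> (1 - ereal \<eta> / L1) / (1 + ereal \<eta> / L2)"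
proof -
  have ninf: "f1 x \<noteq> -\<infinity>" "f2 x \<noteq> -\<infinity>" for x
    using assms(8,9) by (auto simp: F_class_def proper_fun_def)
  have conv: "convex_fun f1" "convex_fun f2"
    using assms(8,9) by (auto simp: F_class_def)
  have "f1 x1 < \<infinity>" "f1 x2 < \<infinity>" "f2 x1 < \<infinity>" "f2 x2 < \<infinity>"
    using assms(16-19) by (auto simp: subdiff_def)
  then obtain a1 a2 b1 b2
    where vals: "f1 x1 = ereal a1" "f1 x2 = ereal a2" "f2 x1 = ereal b1" "f2 x2 = ereal b2"
    using ninf by (metis ereal_cases less_irrefl)
  have f: "f x = (if f1 x = \<infinity> then \<infinity> else f1 x - f2 x)" for x
    by (simp add: assms(10) dc_diff_def)
  have fx: "f x1 = ereal (a1 - b1)" "f x2 = ereal (a2 - b2)"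
    by (simp_all add: f vals)
  obtain g where g2: "g \<in> subdiff f2 x1"
    and amin: "is_arg_min (\<lambda>x. f1 x - f2 x1 - ereal (g \<bullet> (x - x1))) (\<lambda>x. True) x2"
    using assms(20) by (auto simp: DCA_step_def)
  have g1: "g \<in> subdiff f1 x2"
    unfolding subdiff_def
  proof (intro CollectI conjI allI)
    show "f1 x2 < \<infinity>" by (simp add: vals)
    fix y
    have "f1 x2 - f2 x1 - ereal (g \<bullet> (x2 - x1)) \<le> f1 y - f2 x1 - ereal (g \<bullet> (y - x1))"
      using amin by (auto simp: is_arg_min_linorder)
    then show "f1 y \<ge> f1 x2 + ereal (g \<bullet> (y - x2))"
      using ninf(1)[of y] by (cases "f1 y") (auto simp: vals inner_diff_right)
  qed
  have g1': "a2 + g \<bullet> (x1 - x2) \<le> a1"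
  proof -
    have "f1 x2 + ereal (g \<bullet> (x1 - x2)) \<le> f1 x1" using g1 by (simp add: subdiff_def)
    then show ?thesis by (simp add: vals)
  qed
  have g2': "b1 + g \<bullet> (x2 - x1) \<le> b2"
  proof -
    have "f2 x1 + ereal (g \<bullet> (x2 - x1)) \<le> f2 x2" using g2 by (simp add: subdiff_def)
    then show ?thesis by (simp add: vals)
  qed
  have sym: "g \<bullet> (x2 - x1) = - (g \<bullet> (x1 - x2))" by (simp add: inner_diff_right)
  have "f x2 \<le> f x1" using g1' g2' sym by (simp add: fx)
  then have PL: "2 * \<eta> * (v - fstar) \<le> (norm \<xi>)\<^sup>2"
    if "x \<in> {x1, x2}" "\<xi> \<in> convex hull (general_subdiff f x)" "f x = ereal v" for x \<xi> v
  proof -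
    have "f x - ereal fstar \<le> ereal (1 / (2 * \<eta>) * (norm \<xi>)\<^sup>2)"
      using assms(15) that \<open>f x2 \<le> f x1\<close> unfolding PL_inequality_def by blast
    then show ?thesis using \<open>\<eta> > 0\<close> that(3) by (simp add: field_simps)
  qed
  define \<Delta>1 where "\<Delta>1 = a1 - b1 - fstar"
  define \<Delta>2 where "\<Delta>2 = a2 - b2 - fstar"
  have gain1: "a1 \<ge> a2 + g \<bullet> (x1 - x2) + \<eta> / l * \<Delta>1" if L1: "L1 = ereal l" for l
  proof -
    have "l > 0" using assms(1) L1 by simp
    obtain A D where A: "\<And>x. f1 x = ereal (A x)"
      and sub: "\<And>x y. A y \<ge> A x + D x \<bullet> (y - x)"
      and lip: "\<And>x y. norm (D x - D y) \<le> l * norm (x - y)"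
      and uniq: "\<And>x g. g \<in> subdiff f1 x \<Longrightarrow> g = D x"
      using that by (rule smooth_convex_gradient[OF assms(8)[unfolded L1] \<open>l > 0\<close> assms(16)])
    \<comment> \<open>Where \<open>f1\<close> is finite, so is \<open>f2\<close>, since \<open>f\<close> is bounded below.\<close>
    have f2_fin: "f2 x \<noteq> \<infinity>" for x
      using assms(12)[rule_format, of x] by (auto simp: f A)
    define B where "B x = real_of_ereal (f2 x)" for x
    have B: "f2 x = ereal (B x)" for x
      using f2_fin[of x] ninf(2)[of x] by (cases "f2 x") (auto simp: B_def)
    have convB: "convex_on UNIV B" by (rule convex_on_if_convex_fun[OF conv(2) B])
    have "convex_on UNIV A" by (rule convex_on_if_convex_fun[OF conv(1) A])
    then have contA: "continuous_on UNIV A" by (rule convex_on_continuous[OF open_UNIV])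
    have contB: "continuous_on UNIV B" by (rule convex_on_continuous[OF open_UNIV convB])
    have contD: "continuous_on UNIV D"
      using lip \<open>l > 0\<close>
      by (intro lipschitz_on_continuous_on[of l] lipschitz_onI) (auto simp: dist_norm)
    have "B w \<ge> B x1 + g \<bullet> (w - x1)" for w
    proof -
      have "f2 x1 + ereal (g \<bullet> (w - x1)) \<le> f2 w" using g2 by (simp add: subdiff_def)
      then show ?thesis by (simp add: B)
    qed
    from gradient_minus_subgradient_in_hull[OF contA contD
        convex_quadratic_upper_bound[OF sub lip] convB this]
    have "D x1 - g \<in> convex hull (limiting_prox_subdiff (\<lambda>x. A x - B x) x1)" .
    moreover have "limiting_prox_subdiff (\<lambda>x. A x - B x) x1 \<subseteq> general_subdiff f x1"
      by (rule limiting_prox_subset_general_subdiff)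
        (auto simp: f A B intro!: continuous_intros contA contB)
    ultimately have "D x1 - g \<in> convex hull (general_subdiff f x1)"
      using hull_mono by blast
    from PL[OF _ this fx(1)] have "2 * \<eta> * \<Delta>1 \<le> (norm (D x1 - g))\<^sup>2"
      by (simp add: \<Delta>1_def)
    then have "1 / (2 * l) * (2 * \<eta> * \<Delta>1) \<le> 1 / (2 * l) * (norm (D x1 - g))\<^sup>2"
      using \<open>l > 0\<close> by (intro mult_left_mono) auto
    moreover have "1 / (2 * l) * (2 * \<eta> * \<Delta>1) = \<eta> / l * \<Delta>1" by simp
    moreover have "A x1 \<ge> A x2 + D x2 \<bullet> (x1 - x2) + 1 / (2 * l) * (norm (D x1 - D x2))\<^sup>2"
      by (rule convex_gradient_lower_bound[OF \<open>l > 0\<close> sub lip])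
    moreover have "g = D x2" by (rule uniq[OF g1])
    moreover have "A x1 = a1" "A x2 = a2" using A vals by simp_all
    ultimately show ?thesis by simp
  qed
  have gain2: "b2 \<ge> b1 + g \<bullet> (x2 - x1) + \<eta> / l * \<Delta>2" if L2: "L2 = ereal l" for l
  proof -
    have "l > 0" using assms(2) L2 by simp
    obtain B D where B: "\<And>x. f2 x = ereal (B x)"
      and sub: "\<And>x y. B y \<ge> B x + D x \<bullet> (y - x)"
      and lip: "\<And>x y. norm (D x - D y) \<le> l * norm (x - y)"
      and uniq: "\<And>x g. g \<in> subdiff f2 x \<Longrightarrow> g = D x"
      using that by (rule smooth_convex_gradient[OF assms(9)[unfolded L2] \<open>l > 0\<close> assms(17)])
    have Bx: "B x1 = b1" "B x2 = b2" using B vals by simp_all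
    have "g - D x2 \<in> regular_subdiff f x2"
    proof (rule regular_subdiff_if_quadratic_minorant[of _ _ 1 _ "l / 2"])
      fix x
      have "f1 x2 + ereal (g \<bullet> (x - x2)) \<le> f1 x" using g1 by (simp add: subdiff_def)
      moreover have "B x \<le> B x2 + D x2 \<bullet> (x - x2) + l / 2 * (norm (x - x2))\<^sup>2"
        by (rule convex_quadratic_upper_bound[OF sub lip])
      ultimately show "f x2 + ereal ((g - D x2) \<bullet> (x - x2) - l / 2 * (norm (x - x2))\<^sup>2) \<le> f x"
        using ninf(1)[of x] Bx by (cases "f1 x") (auto simp: f vals B inner_diff_left)
    qed (simp_all add: fx)
    then have "g - D x2 \<in> convex hull (general_subdiff f x2)"
      by (intro hull_inc subsetD[OF regular_subset_general_subdiff])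
    from PL[OF _ this fx(2)] have "2 * \<eta> * \<Delta>2 \<le> (norm (D x2 - g))\<^sup>2"
      by (simp add: \<Delta>2_def norm_minus_commute)
    then have "1 / (2 * l) * (2 * \<eta> * \<Delta>2) \<le> 1 / (2 * l) * (norm (D x2 - g))\<^sup>2"
      using \<open>l > 0\<close> by (intro mult_left_mono) auto
    moreover have "1 / (2 * l) * (2 * \<eta> * \<Delta>2) = \<eta> / l * \<Delta>2" by simp
    moreover have "B x2 \<ge> B x1 + D x1 \<bullet> (x2 - x1) + 1 / (2 * l) * (norm (D x2 - D x1))\<^sup>2"
      by (rule convex_gradient_lower_bound[OF \<open>l > 0\<close> sub lip])
    moreover have "g = D x1" by (rule uniq[OF g2])
    ultimately show ?thesis using Bx by simp
  qed
  \<comment> \<open>With \<open>\<eta> / \<infinity> = 0\<close> the plain subgradient inequality covers an infinite constant.\<close>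
  obtain c1 where c1: "ereal \<eta> / L1 = ereal c1" "a1 \<ge> a2 + g \<bullet> (x1 - x2) + c1 * \<Delta>1"
  proof (cases L1)
    case (real l)
    then show thesis using gain1[OF real] assms(1) by (intro that[of "\<eta> / l"]) auto
  next
    case PInf
    then show thesis using g1' by (intro that[of 0]) auto
  next
    case MInf
    then show thesis using assms(1) by simp
  qed
  obtain c2 where c2: "ereal \<eta> / L2 = ereal c2" "c2 \<ge> 0" "b2 \<ge> b1 + g \<bullet> (x2 - x1) + c2 * \<Delta>2"
  proof (cases L2)
    case (real l)
    then show thesis using gain2[OF real] assms(2) \<open>\<eta> > 0\<close> by (intro that[of "\<eta> / l"]) auto
  next
    case PInf
    then show thesis using g2' by (intro that[of 0]) auto
  next
    case MInf
    then show thesis using assms(2) by simp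
  qed
  have "\<Delta>1 > 0" using assms(13) by (simp add: fx \<Delta>1_def)
  have "(1 + c2) * \<Delta>2 \<le> (1 - c1) * \<Delta>1"
    using c1(2) c2(3) sym by (simp add: \<Delta>1_def \<Delta>2_def algebra_simps)
  then have "\<Delta>2 / \<Delta>1 \<le> (1 - c1) / (1 + c2)"
    using \<open>\<Delta>1 > 0\<close> c2(2) by (simp add: field_simps)
  moreover have "1 - ereal \<eta> / L1 = ereal (1 - c1)" "1 + ereal \<eta> / L2 = ereal (1 + c2)"
    by (simp_all add: c1 c2 one_ereal_def)
  moreover have "f x2 - ereal fstar = ereal \<Delta>2" "f x1 - ereal fstar = ereal \<Delta>1"
    by (simp_all add: fx \<Delta>1_def \<Delta>2_def)
  ultimately show ?thesis using \<open>\<Delta>1 > 0\<close> c2(2) by simp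
qed

end
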